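(* Let $V$ be a Euclidean Jordan algebra of dimension at least $2$ with cone of squares $Q$. Let $\mathcal{F}(Q)$ be the family of faces of $Q$, $\mathcal{A}$ the family of Jordan subalgebras of $V$, and $\mathcal{L}$ the family of lattice-like subspaces of $(V,Q)$. Then the following inclusions hold and are both strict: $$\{\operatorname{span} F:\ F\in\mathcal{F}(Q)\}\subsetneq\mathcal{A}\subsetneq\mathcal{L}.$$
   Context: A Euclidean Jordan algebra $V$ is a finite-dimensional real vector space with a commutative bilinear product $(x,y)\mapsto xy$ satisfying $x^2(xy)=x(x^2y)$, with a unit element $e$, and with an inner product $\langle\cdot,\cdot\rangle$ such that $\langle xy,z\rangle=\langle y,xz\rangle$ for all $x,y,z\in V$. Its cone of squares is $Q=\{x^2: x\in V\}$, a closed convex self-dual cone. Write $x\le_Q y$ if $y-x\in Q$. A Jordan subalgebra is a linear subspace of $V$ closed under the product (it need not contain $e$). A (nonempty convex) subcone $F\subset Q$ is a face of $Q$ if $0\le_Q x\le_Q y$ and $y\in F$ imply $x\in F$. For a nonempty closed convex set $D\subset V$, $P_D$ denotes the metric (nearest point) projection onto $D$. The lattice-like operations are $x\sqcap_Q y=P_{x-Q}\,y$ and $x\sqcup_Q y=P_{x+Q}\,y$. A linear subspace $M\subset V$ is a lattice-like subspace of $(V,Q)$ if $x\sqcap_Q y\in M$ and $x\sqcup_Q y\in M$ for all $x,y\in M$. *)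

theory Defs
  imports "HOL-Analysis.Analysis"
begin

(* The associative inner product is the inner product of the ambient Euclidean space, so that
   metric projections are taken with respect to it. *)
locale euclidean_jordan_algebra =
  fixes jmult :: "'a::euclidean_space \<Rightarrow> 'a \<Rightarrow> 'a"  (infixl "\<odot>" 70)
    and e :: 'a
  assumes bilinear_mult: "bilinear (\<odot>)"
    and mult_commute: "x \<odot> y = y \<odot> x"
    and jordan_identity: "(x \<odot> x) \<odot> (x \<odot> y) = x \<odot> ((x \<odot> x) \<odot> y)"
    and unit_left: "e \<odot> x = x"
    and inner_assoc: "inner (x \<odot> y) z = inner y (x \<odot> z)"

definition cone_of_squares :: "('a \<Rightarrow> 'a \<Rightarrow> 'a) \<Rightarrow> 'a set" where
  "cone_of_squares jmult = {jmult x x | x. True}"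

definition cone_le :: "'a::euclidean_space set \<Rightarrow> 'a \<Rightarrow> 'a \<Rightarrow> bool" where
  "cone_le Q x y \<longleftrightarrow> y - x \<in> Q"

(* Faces in the order-theoretic sense; unlike with face_of, the empty set is excluded
   (by convex_cone). *)
definition cone_face :: "'a::euclidean_space set \<Rightarrow> 'a set \<Rightarrow> bool" where
  "cone_face Q F \<longleftrightarrow> F \<subseteq> Q \<and> convex_cone F \<and>
     (\<forall>x y. cone_le Q 0 x \<and> cone_le Q x y \<and> y \<in> F \<longrightarrow> x \<in> F)"

(* A subalgebra need not contain the unit. *)
definition jordan_subalgebra :: "('a::euclidean_space \<Rightarrow> 'a \<Rightarrow> 'a) \<Rightarrow> 'a set \<Rightarrow> bool" where
  "jordan_subalgebra jmult M \<longleftrightarrow> subspace M \<and> (\<forall>x\<in>M. \<forall>y\<in>M. jmult x y \<in> M)"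

(* For nonempty closed convex sets, closest_point is the metric projection. *)
definition lattice_inf :: "'a::euclidean_space set \<Rightarrow> 'a \<Rightarrow> 'a \<Rightarrow> 'a" where
  "lattice_inf Q x y = closest_point ((\<lambda>q. x - q) ` Q) y"

definition lattice_sup :: "'a::euclidean_space set \<Rightarrow> 'a \<Rightarrow> 'a \<Rightarrow> 'a" where
  "lattice_sup Q x y = closest_point ((\<lambda>q. x + q) ` Q) y"

definition lattice_like_subspace :: "'a::euclidean_space set \<Rightarrow> 'a set \<Rightarrow> bool" where
  "lattice_like_subspace Q M \<longleftrightarrow>
     subspace M \<and> (\<forall>x\<in>M. \<forall>y\<in>M. lattice_inf Q x y \<in> M \<and> lattice_sup Q x y \<in> M)"

end

theory Submission
  imports Defs
begin

text \<open>
  The powers of an element \<open>x\<close> span an associative subalgebra, which is spanned by finitely many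
  pairwise orthogonal idempotents; hence \<open>x\<close> has a spectral decomposition inside any subalgebra
  containing it. An idempotent of a subalgebra is found by maximising \<open>\<langle>u\<^sup>2, u\<rangle>\<close> over the unit sphere:
  the first-order condition makes \<open>u\<^sup>2\<close> a multiple of \<open>u\<close>, and the second-order condition makes the
  idempotent primitive.

  Separating the positive and negative coefficients of \<open>x\<close> yields \<open>x = p - m\<close> with \<open>p, m\<close> orthogonal
  squares, and \<open>p\<close> is the projection of \<open>x\<close> onto \<open>Q\<close>. So subalgebras are lattice-like. For a face
  \<open>F\<close> and \<open>a \<in> F\<close> some multiple of \<open>a\<close> dominates \<open>a\<^sup>2\<close>, whence \<open>a\<^sup>2 \<in> F\<close>, and polarisation
  shows that \<open>span F\<close> is a subalgebra. The inclusions are strict because \<open>\<real>e\<close> is not the span of a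
  face, \<open>e\<close> being an order unit, and because \<open>\<real>q\<close> is lattice-like for each \<open>q \<in> Q\<close>, while
  \<open>q\<^sup>2 \<in> \<real>q\<close> fails for some \<open>q\<close>.
\<close>

section \<open>Real inequalities for a second-order maximum test\<close>

lemma quartic_nonpos_coeffs:
  fixes a b c d :: real
  assumes le: "\<And>t. a * t + b * t^2 + c * t^3 + d * t^4 \<le> 0"
  shows "a = 0" "b \<le> 0"
proof -
  have "((\<lambda>t. a * t + b * t^2 + c * t^3 + d * t^4) has_real_derivative a) (at 0)"
    by (auto intro!: derivative_eq_intros)
  then show a: "a = 0"
    by (rule DERIV_local_max[where d = 1]) (use le in auto)
  \<comment> \<open>With \<open>a = 0\<close>, divide by \<open>t^2\<close> for nonzero
    \<open>t\<close>; the limit at 0 leaves \<open>b\<close>.\<close>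
  have "b + c * t + d * t^2 \<le> 0" if "t \<noteq> 0" for t
  proof -
    have "t^2 * (b + c * t + d * t^2) \<le> 0"
      using le[of t] a by (simp add: algebra_simps power2_eq_square power3_eq_cube power4_eq_xxxx)
    with that show ?thesis
      by (simp add: mult_le_0_iff zero_less_power2)
  qed
  moreover have "((\<lambda>t. b + c * t + d * t^2) \<longlongrightarrow> b + c * 0 + d * 0^2) (at 0)"
    by (intro tendsto_intros)
  ultimately show "b \<le> 0"
    using tendsto_upperbound[of "\<lambda>t. b + c * t + d * t^2" "b + c * 0 + d * 0^2" "at 0" 0]
    by (auto simp: eventually_at_filter)
qed

text \<open>The bound is the second Taylor polynomial of \<open>(1 + s)\<close> to the power 3/2 at
  \<open>s = t^2\<close>. It turns the cubed norm in \<open>ex_idempotent\<close> into a polynomial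
  to which \<open>quartic_nonpos_coeffs\<close> applies.\<close>

lemma sqrt_cube_le:
  fixes t :: real
  shows "sqrt (1 + t^2) ^ 3 \<le> 1 + 3/2 * t^2 + 3/8 * t^4"
proof -
  have "(sqrt (1 + t^2) ^ 3)^2 = (1 + t^2)^3"
    by (metis power_mult mult.commute real_sqrt_pow2 add_nonneg_nonneg zero_le_one zero_le_power2)
  also have "\<dots> \<le> (1 + 3/2 * t^2 + 3/8 * t^4)^2"
  proof -
    have "(1 + 3/2 * t^2 + 3/8 * t^4)^2 - (1 + t^2)^3 = t^6 / 8 + 9/64 * t^8"
      by (simp add: power2_eq_square power3_eq_cube algebra_simps power_numeral_reduce)
    moreover have "t^6 / 8 + 9/64 * t^8 \<ge> 0"
      by (simp add: zero_le_even_power)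
    ultimately show ?thesis by linarith
  qed
  finally show ?thesis
    by (rule power2_le_imp_le) (simp add: zero_le_even_power)
qed

context euclidean_jordan_algebra
begin

section \<open>Bilinear calculus and power associativity\<close>

lemmas mult_simps =
  bilinear_ladd[OF bilinear_mult] bilinear_radd[OF bilinear_mult]
  bilinear_lsub[OF bilinear_mult] bilinear_rsub[OF bilinear_mult]
  bilinear_lmul[OF bilinear_mult] bilinear_rmul[OF bilinear_mult]
  bilinear_lneg[OF bilinear_mult] bilinear_rneg[OF bilinear_mult]
  bilinear_lzero[OF bilinear_mult] bilinear_rzero[OF bilinear_mult]

lemma linear_mult: "linear ((\<odot>) a)"
  using bilinear_mult by (simp add: bilinear_def)

lemma unit_right: "x \<odot> e = x"
  using unit_left mult_commute by metis

lemma inner_mult_unit: "inner (x \<odot> y) e = inner x y"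
  using inner_assoc[of x y e] by (simp add: unit_right inner_commute)

lemma square_eq_0: "x \<odot> x = 0 \<Longrightarrow> x = 0"
  using inner_mult_unit[of x x] by simp

text \<open>The part of the Jordan identity for \<open>x + z\<close> that is linear in \<open>z\<close>; it is isolated by combining
  the identities for \<open>x + z\<close>, \<open>x - z\<close> and \<open>z\<close>.\<close>

lemma jordan_linearized:
  "2 *\<^sub>R ((x \<odot> z) \<odot> (x \<odot> y)) + (x \<odot> x) \<odot> (z \<odot> y)
     = z \<odot> ((x \<odot> x) \<odot> y) + 2 *\<^sub>R (x \<odot> ((x \<odot> z) \<odot> y))"
proof -
  define l where "l w = (w \<odot> w) \<odot> (w \<odot> y) - w \<odot> ((w \<odot> w) \<odot> y)" for w
  have l0: "l w = 0" for w
    by (simp add: l_def jordan_identity)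
  have "l (x + z) - l (x - z) - 2 *\<^sub>R l z =
     2 *\<^sub>R (2 *\<^sub>R ((x \<odot> z) \<odot> (x \<odot> y)) + (x \<odot> x) \<odot> (z \<odot> y)
      - z \<odot> ((x \<odot> x) \<odot> y) - 2 *\<^sub>R (x \<odot> ((x \<odot> z) \<odot> y)))"
    unfolding l_def mult_commute[of z x] mult_simps
    by (simp add: mult_commute[of z x] mult_simps scaleR_2 algebra_simps)
  then have "2 *\<^sub>R ((x \<odot> z) \<odot> (x \<odot> y)) + (x \<odot> x) \<odot> (z \<odot> y)
      - z \<odot> ((x \<odot> x) \<odot> y) - 2 *\<^sub>R (x \<odot> ((x \<odot> z) \<odot> y)) = 0"
    unfolding l0 by simp
  then show ?thesis
    by (simp add: algebra_simps)
qed

text \<open>Powers without constant term: \<open>pow1 x n\<close> is \<open>x\<^sup>n\<^sup>+\<^sup>1\<close>, so that they stay in any subalgebra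
  containing \<open>x\<close>.\<close>

fun pow1 :: "'a \<Rightarrow> nat \<Rightarrow> 'a" where
  "pow1 x 0 = x"
| "pow1 x (Suc n) = x \<odot> pow1 x n"

lemma square_mult_pow1: "(x \<odot> x) \<odot> pow1 x n = pow1 x (Suc (Suc n))"
  by (induction n) (simp_all add: jordan_identity mult_commute)

text \<open>Linearising at \<open>y = pow1 x n\<close> expresses multiplication by a power of
  \<open>x\<close> through multiplications by \<open>x\<close>, \<open>x \<odot> x\<close> and lower
  powers. This recursion drives the next induction.\<close>

lemma mult_pow1_Suc_Suc:
  "pow1 x (Suc (Suc n)) \<odot> z =
     (x \<odot> x) \<odot> (pow1 x n \<odot> z) + 2 *\<^sub>R (pow1 x (Suc n) \<odot> (x \<odot> z)) - 2 *\<^sub>R (x \<odot> (pow1 x n \<odot> (x \<odot> z)))"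
  using jordan_linearized[of x z "pow1 x n"]
  unfolding square_mult_pow1
  by (simp add: mult_commute algebra_simps)

text \<open>By the recursion, multiplication by any power is a polynomial in the multiplications by
  \<open>x\<close> and \<open>x \<odot> x\<close>, so commuting with these two suffices.\<close>

lemma commute_pow1:
  assumes S: "\<And>z. x \<odot> (a \<odot> z) = a \<odot> (x \<odot> z)" "\<And>z. (x \<odot> x) \<odot> (a \<odot> z) = a \<odot> ((x \<odot> x) \<odot> z)"
  shows "pow1 x n \<odot> (a \<odot> z) = a \<odot> (pow1 x n \<odot> z)"
proof (induction n arbitrary: z rule: less_induct)
  case (less n)
  consider "n = 0" | "n = 1" | k where "n = Suc (Suc k)"
    by (metis One_nat_def not0_implies_Suc)
  then show ?case
  proof cases
    case (3 k)
    have "pow1 x k \<odot> (a \<odot> z) = a \<odot> (pow1 x k \<odot> z)"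
      "pow1 x (Suc k) \<odot> (a \<odot> z) = a \<odot> (pow1 x (Suc k) \<odot> z)" for z
      using less 3 by (simp_all del: pow1.simps)
    then show ?thesis
      unfolding 3 mult_pow1_Suc_Suc by (simp add: S mult_simps del: pow1.simps)
  qed (use S in simp_all)
qed

text \<open>\<open>commute_pow1\<close> is used twice: its two conditions for
  \<open>a = pow1 x n\<close> are again instances of it, with \<open>a = x\<close> and
  \<open>a = x \<odot> x\<close>, and these reduce to the Jordan identity.\<close>

lemma pow1_commute: "pow1 x m \<odot> (pow1 x n \<odot> z) = pow1 x n \<odot> (pow1 x m \<odot> z)"
  by (intro commute_pow1 commute_pow1[symmetric] jordan_identity jordan_identity[symmetric] refl)

lemma pow1_add: "pow1 x m \<odot> pow1 x n = pow1 x (Suc (m + n))"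
proof (induction n)
  case 0
  then show ?case by (simp add: mult_commute)
next
  case (Suc n)
  then show ?case using pow1_commute[of x m 0 "pow1 x n"] by simp
qed

section \<open>The subalgebra generated by one element\<close>

definition generated :: "'a \<Rightarrow> 'a set" where
  "generated x = span (range (pow1 x))"

lemma generated_subalgebra: "jordan_subalgebra (\<odot>) (generated x)"
  unfolding jordan_subalgebra_def
proof (intro conjI ballI)
  show "subspace (generated x)" by (simp add: generated_def)
  fix a b assume ab: "a \<in> generated x" "b \<in> generated x"
  have pow: "pow1 x m \<odot> b \<in> generated x" for m
    using ab(2) unfolding generated_def
    by (induction rule: span_induct_alt)
      (auto simp: mult_simps pow1_add simp del: pow1.simps
          intro!: span_zero span_add span_mul intro: span_base)
  show "a \<odot> b \<in> generated x"
    using ab(1) unfolding generated_def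
    by (induction rule: span_induct_alt)
      (auto simp: mult_simps pow[unfolded generated_def] intro!: span_zero span_add span_mul)
qed

lemma generated_subset:
  assumes "jordan_subalgebra (\<odot>) M" "x \<in> M"
  shows "generated x \<subseteq> M"
proof -
  have "pow1 x n \<in> M" for n
    using assms by (induction n) (auto simp: jordan_subalgebra_def)
  then show ?thesis
    using assms unfolding generated_def jordan_subalgebra_def by (intro span_minimal) auto
qed

lemma mem_generated: "x \<in> generated x"
  unfolding generated_def using rangeI[of "pow1 x" 0] by (simp add: span_base)

text \<open>Commutation of powers extends linearly in both arguments. Combined with
  \<open>mult_commute\<close> it makes \<open>generated x\<close> associative.\<close>

lemma generated_commute:
  assumes "a \<in> generated x" "b \<in> generated x"
  shows "a \<odot> (b \<odot> z) = b \<odot> (a \<odot> z)"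
proof -
  have "pow1 x m \<odot> (b \<odot> z) = b \<odot> (pow1 x m \<odot> z)" for m z
    using assms(2) unfolding generated_def
    by (induction rule: span_induct_alt) (auto simp: mult_simps pow1_commute)
  with assms(1) show ?thesis
    unfolding generated_def
    by (induction rule: span_induct_alt) (auto simp: mult_simps)
qed

section \<open>Idempotents and the spectral decomposition\<close>

definition orthogonal_idempotents :: "'a set \<Rightarrow> bool" where
  "orthogonal_idempotents C \<longleftrightarrow> finite C \<and> 0 \<notin> C \<and> (\<forall>c\<in>C. \<forall>d\<in>C. c \<odot> d = (if c = d then c else 0))"

text \<open>The last conclusion is a form of primitivity: if \<open>h\<close> in \<open>A\<close> is
  orthogonal to \<open>c\<close> and \<open>c \<odot> h = h\<close>, then the bound forces
  \<open>h = 0\<close>.\<close>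

lemma ex_idempotent:
  assumes A: "jordan_subalgebra (\<odot>) A" and "A \<noteq> {0}"
  obtains c where "c \<in> A" "c \<noteq> 0" "c \<odot> c = c"
    "\<And>h. h \<in> A \<Longrightarrow> inner c h = 0 \<Longrightarrow> inner (c \<odot> h) h \<le> inner h h / 2"
proof -
  have sub: "subspace A" and closed: "\<And>x y. x \<in> A \<Longrightarrow> y \<in> A \<Longrightarrow> x \<odot> y \<in> A"
    using A by (auto simp: jordan_subalgebra_def)
  define f where "f u = inner (u \<odot> u) u" for u
  have "compact (A \<inter> sphere 0 1)"
    using sub by (simp add: closed_subspace closed_Int_compact)
  moreover have "A \<inter> sphere 0 1 \<noteq> {}"
  proof -
    obtain a where "a \<in> A" "a \<noteq> 0"
      using \<open>A \<noteq> {0}\<close> sub subspace_0 by blast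
    then have "(1 / norm a) *\<^sub>R a \<in> A \<inter> sphere 0 1"
      using sub by (simp add: subspace_mul)
    then show ?thesis by blast
  qed
  moreover have "continuous_on (A \<inter> sphere 0 1) f"
  proof -
    have "bounded_bilinear (\<odot>)"
      using bilinear_mult by (simp add: bilinear_conv_bounded_bilinear)
    then show ?thesis
      unfolding f_def
      by (intro continuous_intros bounded_bilinear.continuous_on[of "(\<odot>)"])
  qed
  ultimately obtain u where "u \<in> A \<inter> sphere 0 1" "\<forall>v \<in> A \<inter> sphere 0 1. f v \<le> f u"
    using continuous_attains_sup by blast
  then have u: "u \<in> A" "norm u = 1"
    and max: "\<And>v. v \<in> A \<Longrightarrow> norm v = 1 \<Longrightarrow> f v \<le> f u"
    by auto
  define l where "l = f u"
  have f_scale: "f (r *\<^sub>R v) = r^3 * f v" for r v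
    by (simp add: f_def mult_simps power3_eq_cube)
  have f_le: "f v \<le> l * norm v ^ 3" if "v \<in> A" for v
  proof (cases "v = 0")
    case False
    have "f ((1 / norm v) *\<^sub>R v) \<le> l"
      unfolding l_def by (rule max) (use that sub False in \<open>auto simp: subspace_mul\<close>)
    then show ?thesis
      using False unfolding f_scale by (simp add: field_simps)
  qed (simp add: f_def)
  \<comment> \<open>\<open>f\<close> is odd, so the bound at \<open>- u\<close> reads
    \<open>- l \<le> l\<close>.\<close>
  have "0 \<le> l"
    using f_le[of "- u"] u sub by (simp add: l_def f_def mult_simps subspace_neg)
  have crit: "inner (u \<odot> u) h = 0" "inner (u \<odot> h) h \<le> l / 2"
    if h: "h \<in> A" "norm h = 1" "inner u h = 0" for h
  proof -
    \<comment> \<open>Since \<open>f\<close> is homogeneous of degree 3, the straight path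
      \<open>u + t *\<^sub>R h\<close> can be used without normalising it: expand \<open>f\<close>
      on the path and compare with \<open>l\<close> times the bound for the cubed norm.\<close>
    have "(3 * inner (u \<odot> u) h) * t + (3 * inner (u \<odot> h) h - 3/2 * l) * t^2
        + f h * t^3 + (- 3/8 * l) * t^4 \<le> 0" for t
    proof -
      have "norm (u + t *\<^sub>R h) = sqrt (1 + t^2)"
        unfolding norm_eq_sqrt_inner using u h
        by (simp add: inner_simps inner_commute power2_eq_square norm_eq_1)
      then have "f (u + t *\<^sub>R h) \<le> l * sqrt (1 + t^2) ^ 3"
        using f_le[of "u + t *\<^sub>R h"] u h sub by (simp add: subspace_add subspace_mul)
      also have "\<dots> \<le> l * (1 + 3/2 * t^2 + 3/8 * t^4)"
        using sqrt_cube_le \<open>0 \<le> l\<close> by (intro mult_left_mono)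
      finally have "f (u + t *\<^sub>R h) \<le> l * (1 + 3/2 * t^2 + 3/8 * t^4)" .
      moreover have "f (u + t *\<^sub>R h)
          = l + 3 * inner (u \<odot> u) h * t + 3 * inner (u \<odot> h) h * t^2 + f h * t^3"
      proof -
        have "inner (u \<odot> h) u = inner (u \<odot> u) h"
          by (metis inner_assoc inner_commute mult_commute)
        moreover have "inner (h \<odot> h) u = inner (u \<odot> h) h"
          by (metis inner_assoc inner_commute mult_commute)
        ultimately show ?thesis
          unfolding f_def l_def
          by (simp add: mult_simps inner_simps mult_commute[of h u] power2_eq_square power3_eq_cube
              algebra_simps)
      qed
      ultimately show ?thesis by (simp add: algebra_simps)
    qed
    from quartic_nonpos_coeffs[OF this]
    show "inner (u \<odot> u) h = 0" "inner (u \<odot> h) h \<le> l / 2" by simp_all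
  qed
  have scale: "\<exists>k. h = norm h *\<^sub>R k \<and> k \<in> A \<and> norm k = 1 \<and> inner u k = 0"
    if "h \<in> A" "h \<noteq> 0" "inner u h = 0" for h
    using that sub by (intro exI[of _ "(1 / norm h) *\<^sub>R h"]) (simp add: subspace_mul)
  have uu: "u \<odot> u = l *\<^sub>R u"
  proof (rule ccontr)
    assume neq: "u \<odot> u \<noteq> l *\<^sub>R u"
    \<comment> \<open>The component of \<open>u \<odot> u\<close> orthogonal to \<open>u\<close>;
      the first-order condition makes it vanish.\<close>
    define h where "h = u \<odot> u - l *\<^sub>R u"
    have h: "h \<in> A" "h \<noteq> 0" "inner u h = 0"
      using u closed sub neq
      by (auto simp: h_def subspace_diff subspace_mul inner_simps l_def f_def inner_commute norm_eq_1)
    obtain k where k: "h = norm h *\<^sub>R k" "k \<in> A" "norm k = 1" "inner u k = 0"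
      using scale[OF h] by blast
    have "inner (u \<odot> u) h = 0"
      using crit(1)[OF k(2-4)] by (subst k(1)) simp
    then have "inner h h = 0"
      using h(3) by (simp add: h_def inner_simps inner_commute)
    with h show False by simp
  qed
  have "u \<noteq> 0" using u by auto
  with uu square_eq_0[of u] have "l \<noteq> 0" by auto
  with \<open>0 \<le> l\<close> have "l > 0" by simp
  define c where "c = (1 / l) *\<^sub>R u"
  show thesis
  proof
    show "c \<in> A" "c \<noteq> 0" "c \<odot> c = c"
      using u sub \<open>u \<noteq> 0\<close> \<open>l > 0\<close> by (auto simp: c_def subspace_mul mult_simps uu)
    fix h assume "h \<in> A" "inner c h = 0"
    show "inner (c \<odot> h) h \<le> inner h h / 2"
    proof (cases "h = 0")
      case False
      have "inner u h = 0" using \<open>inner c h = 0\<close> \<open>l > 0\<close> by (simp add: c_def)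
      then obtain k where k: "h = norm h *\<^sub>R k" "k \<in> A" "norm k = 1" "inner u k = 0"
        using scale[OF \<open>h \<in> A\<close> False] by blast
      define r where "r = norm h"
      have hk: "h = r *\<^sub>R k" using k r_def by simp
      have "inner (c \<odot> k) k \<le> 1 / 2"
        using crit(2)[OF k(2-4)] \<open>l > 0\<close> by (simp add: c_def mult_simps field_simps)
      then have "r^2 * inner (c \<odot> k) k \<le> r^2 * (1 / 2)"
        by (intro mult_left_mono) auto
      then show ?thesis
        using k(3) by (simp add: hk mult_simps norm_eq_1 power2_eq_square)
    qed (simp add: mult_simps)
  qed
qed

text \<open>By associativity, multiplication by an idempotent \<open>c\<close> is a projection on
  \<open>A\<close>. Its image is the line through \<open>c\<close> by primitivity, and its kernel
  \<open>B\<close> is an associative subalgebra of smaller dimension, to which induction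
  applies.\<close>

lemma orthogonal_idempotents_span:
  assumes "jordan_subalgebra (\<odot>) A"
    and "\<And>x y z. x \<in> A \<Longrightarrow> y \<in> A \<Longrightarrow> z \<in> A \<Longrightarrow> x \<odot> (y \<odot> z) = (x \<odot> y) \<odot> z"
  shows "\<exists>C\<subseteq>A. orthogonal_idempotents C \<and> A \<subseteq> span C"
  using assms
proof (induction "dim A" arbitrary: A rule: less_induct)
  case less
  have sub: "subspace A" and closed: "\<And>x y. x \<in> A \<Longrightarrow> y \<in> A \<Longrightarrow> x \<odot> y \<in> A"
    using less.prems(1) by (auto simp: jordan_subalgebra_def)
  show ?case
  proof (cases "A = {0}")
    case True
    then show ?thesis
      by (intro exI[of _ "{}"]) (simp add: orthogonal_idempotents_def)
  next
    case False
    then obtain c where c: "c \<in> A" "c \<noteq> 0" "c \<odot> c = c"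
      and primitive: "\<And>h. h \<in> A \<Longrightarrow> inner c h = 0 \<Longrightarrow> inner (c \<odot> h) h \<le> inner h h / 2"
      using ex_idempotent[OF less.prems(1)] by metis
    have cc: "c \<odot> (c \<odot> a) = c \<odot> a" if "a \<in> A" for a
      using less.prems(2)[of c c a] c that by simp
    define B where "B = {a \<in> A. c \<odot> a = 0}"
    have "subspace B"
      using sub by (auto simp: B_def subspace_def mult_simps)
    moreover have "x \<odot> y \<in> B" if "x \<in> B" "y \<in> B" for x y
      using that less.prems(2)[of c x y] c closed by (auto simp: B_def mult_simps)
    ultimately have B: "jordan_subalgebra (\<odot>) B"
      by (simp add: jordan_subalgebra_def)
    have "dim B < dim A"
    proof (rule dim_psubset)
      have spans: "span B = B" "span A = A"
        using \<open>subspace B\<close> sub by (simp_all add: span_eq_iff)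
      have "c \<notin> B" using c by (simp add: B_def)
      moreover have "B \<subseteq> A" by (auto simp: B_def)
      ultimately show "span B \<subset> span A" unfolding spans using c(1) by blast
    qed
    then obtain C where C: "C \<subseteq> B" "orthogonal_idempotents C" "B \<subseteq> span C"
      using less.hyps[OF _ B] less.prems(2) by (auto simp: B_def)
    have "c \<odot> d = 0" "d \<odot> c = 0" if "d \<in> C" for d
      using that C(1) mult_commute[of d c] by (auto simp: B_def)
    then have "orthogonal_idempotents (insert c C)"
      using C(2) c unfolding orthogonal_idempotents_def by auto
    moreover have "a \<in> span (insert c C)" if a: "a \<in> A" for a
    proof -
      \<comment> \<open>\<open>h\<close> is the part of \<open>c \<odot> a\<close> orthogonal to
        \<open>c\<close>. It is fixed by \<open>c\<close>, hence zero by primitivity.\<close>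
      define t where "t = inner (c \<odot> a) c / inner c c"
      define h where "h = c \<odot> a - t *\<^sub>R c"
      have "h \<in> A"
        using a c closed sub by (simp add: h_def subspace_diff subspace_mul)
      moreover have "inner c h = 0"
        using c by (simp add: h_def t_def inner_simps inner_commute)
      moreover have "c \<odot> h = h"
        using a c cc by (simp add: h_def mult_simps)
      ultimately have "inner h h \<le> inner h h / 2"
        using primitive[of h] by simp
      then have "h = 0"
        using inner_ge_zero[of h] inner_eq_zero_iff[of h] by linarith
      have "a - c \<odot> a \<in> B"
        using a c cc closed sub by (simp add: B_def mult_simps subspace_diff)
      then have "a - c \<odot> a \<in> span (insert c C)"
        using C(3) span_mono[of C "insert c C"] by blast
      moreover have "c \<odot> a \<in> span (insert c C)"
        using \<open>h = 0\<close> by (simp add: h_def span_base span_mul)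
      ultimately show ?thesis
        using span_add[of "a - c \<odot> a" "insert c C" "c \<odot> a"] by simp
    qed
    ultimately show ?thesis
      using C(1) c by (intro exI[of _ "insert c C"]) (auto simp: B_def)
  qed
qed

lemma spectral_decomposition:
  assumes "jordan_subalgebra (\<odot>) M" "x \<in> M"
  obtains C l where "C \<subseteq> M" "orthogonal_idempotents C" "x = (\<Sum>c\<in>C. l c *\<^sub>R c)"
proof -
  have "a \<odot> (b \<odot> c) = (a \<odot> b) \<odot> c"
    if "a \<in> generated x" "b \<in> generated x" "c \<in> generated x" for a b c
    using that generated_commute[of a x c b] by (metis mult_commute)
  from orthogonal_idempotents_span[OF generated_subalgebra this]
  obtain C where C: "C \<subseteq> generated x" "orthogonal_idempotents C" "generated x \<subseteq> span C"
    by blast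
  moreover from C obtain l where "x = (\<Sum>c\<in>C. l c *\<^sub>R c)"
    using mem_generated[of x] by (auto simp: span_finite orthogonal_idempotents_def)
  moreover have "C \<subseteq> M"
    using C(1) generated_subset[OF assms] by blast
  ultimately show thesis using that by blast
qed

lemma mult_combinations:
  assumes "orthogonal_idempotents C"
  shows "(\<Sum>c\<in>C. l c *\<^sub>R c) \<odot> (\<Sum>c\<in>C. m c *\<^sub>R c) = (\<Sum>c\<in>C. (l c * m c) *\<^sub>R c)"
proof -
  have fin: "finite C" and orth: "\<And>c d. c \<in> C \<Longrightarrow> d \<in> C \<Longrightarrow> c \<odot> d = (if c = d then c else 0)"
    using assms by (auto simp: orthogonal_idempotents_def)
  have "(\<Sum>c\<in>C. l c *\<^sub>R c) \<odot> y = (\<Sum>c\<in>C. l c *\<^sub>R (c \<odot> y))" for y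
    using linear_sum[OF linear_mult, of y "\<lambda>c. l c *\<^sub>R c" C]
    by (simp add: mult_commute[of _ y] mult_simps)
  moreover have "c \<odot> (\<Sum>d\<in>C. m d *\<^sub>R d) = m c *\<^sub>R c" if "c \<in> C" for c
  proof -
    have "c \<odot> (\<Sum>d\<in>C. m d *\<^sub>R d) = (\<Sum>d\<in>C. m d *\<^sub>R (c \<odot> d))"
      using linear_sum[OF linear_mult, of c "\<lambda>d. m d *\<^sub>R d" C] by (simp add: mult_simps)
    also have "\<dots> = (\<Sum>d\<in>C. if d = c then m c *\<^sub>R c else 0)"
      using that by (intro sum.cong) (auto simp: orth)
    finally show ?thesis using fin that by simp
  qed
  ultimately show ?thesis by simp
qed

section \<open>Positivity of the cone of squares\<close>

abbreviation squares :: "'a set" where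
  "squares \<equiv> cone_of_squares (\<odot>)"

lemma square_mem: "y \<odot> y \<in> squares"
  by (auto simp: cone_of_squares_def)

lemma zero_mem: "0 \<in> squares"
  using square_mem[of 0] by (simp add: mult_simps)

lemma scale_mem: "q \<in> squares \<Longrightarrow> 0 \<le> r \<Longrightarrow> r *\<^sub>R q \<in> squares"
  using square_mem[of "sqrt r *\<^sub>R y" for y] by (auto simp: cone_of_squares_def mult_simps)

lemma nonneg_combination_mem:
  assumes "orthogonal_idempotents C" "\<And>c. c \<in> C \<Longrightarrow> 0 \<le> l c"
  shows "(\<Sum>c\<in>C. l c *\<^sub>R c) \<in> squares"
proof -
  have "(\<Sum>c\<in>C. l c *\<^sub>R c) = (\<Sum>c\<in>C. sqrt (l c) *\<^sub>R c) \<odot> (\<Sum>c\<in>C. sqrt (l c) *\<^sub>R c)"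
    unfolding mult_combinations[OF assms(1)] by (intro sum.cong) (simp_all add: assms(2))
  then show ?thesis using square_mem by simp
qed

text \<open>Multiplication \<open>T\<close> by an idempotent satisfies \<open>2 T\<^sup>3 = 3 T\<^sup>2 - T\<close>, hence
  \<open>T = T\<^sup>2 + 4 (T - T\<^sup>2)\<^sup>2\<close>, which is positive semidefinite.\<close>

lemma inner_idempotent_square_nonneg:
  assumes "c \<odot> c = c"
  shows "0 \<le> inner c (y \<odot> y)"
proof -
  let ?T = "(\<odot>) c"
  have T3: "2 *\<^sub>R ?T (?T y) + ?T (?T y) = ?T y + 2 *\<^sub>R ?T (?T (?T y))"
    using jordan_linearized[of c y c]
    unfolding assms mult_commute[of y c] mult_commute[of "c \<odot> y" c] .
  have sa: "inner (?T a) b = inner a (?T b)" for a b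
    by (simp add: inner_assoc)
  \<comment> \<open>These are the inner products of \<open>T^k y\<close> with \<open>y\<close> for
    \<open>k\<close> from 1 to 4. Pairing \<open>T3\<close> with \<open>y\<close> and
    \<open>T y\<close> gives the two relations below. They imply
    \<open>q - 2 * r + s = (q - r) / 2\<close>, so \<open>r \<le> q\<close> and
    \<open>p = q + 2 * (q - r)\<close> is nonnegative.\<close>
  define p where "p = inner (?T y) y"
  define q where "q = inner (?T y) (?T y)"
  define r where "r = inner (?T (?T y)) (?T y)"
  define s where "s = inner (?T (?T y)) (?T (?T y))"
  have 1: "3 * q = p + 2 * r"
    using arg_cong[OF T3, of "\<lambda>v. inner v y"] by (simp add: inner_simps sa p_def q_def r_def)
  have 2: "3 * r = q + 2 * s"
    using arg_cong[OF T3, of "\<lambda>v. inner v (?T y)"] by (simp add: inner_simps sa q_def r_def s_def)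
  have "inner (?T y - ?T (?T y)) (?T y - ?T (?T y)) = q - 2 * r + s"
    by (simp add: inner_simps inner_commute q_def r_def s_def)
  then have "0 \<le> q - 2 * r + s"
    by (metis inner_ge_zero)
  moreover have "0 \<le> q" by (simp add: q_def)
  ultimately have "0 \<le> p" using 1 2 by linarith
  moreover have "inner c (y \<odot> y) = p"
    unfolding p_def by (metis inner_assoc inner_commute mult_commute)
  ultimately show ?thesis by simp
qed

text \<open>Decomposing a square root of \<open>p\<close> writes \<open>p\<close> as a nonnegative
  combination of idempotents, which reduces the claim to the previous lemma.\<close>

lemma inner_squares_nonneg:
  assumes "p \<in> squares" "q \<in> squares"
  shows "0 \<le> inner p q"
proof -
  obtain x y where p: "p = x \<odot> x" and q: "q = y \<odot> y"
    using assms by (auto simp: cone_of_squares_def)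
  obtain C l where C: "orthogonal_idempotents C" and x: "x = (\<Sum>c\<in>C. l c *\<^sub>R c)"
    using spectral_decomposition[of UNIV x] by (auto simp: jordan_subalgebra_def)
  have "p = (\<Sum>c\<in>C. (l c * l c) *\<^sub>R c)"
    unfolding p x mult_combinations[OF C] ..
  moreover have "0 \<le> inner c q" if "c \<in> C" for c
    using that C inner_idempotent_square_nonneg[of c y] by (auto simp: orthogonal_idempotents_def q)
  ultimately show ?thesis
    by (simp add: inner_sum_left sum_nonneg)
qed

section \<open>Positive parts, projections and lattice-like subspaces\<close>

lemma pos_neg_parts:
  assumes "jordan_subalgebra (\<odot>) M" "x \<in> M"
  obtains p m where "p \<in> M" "p \<in> squares" "m \<in> squares" "x = p - m" "inner p m = 0"
proof -
  obtain C l where C: "C \<subseteq> M" "orthogonal_idempotents C" and x: "x = (\<Sum>c\<in>C. l c *\<^sub>R c)"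
    using spectral_decomposition[OF assms] by blast
  define p where "p = (\<Sum>c\<in>C. max (l c) 0 *\<^sub>R c)"
  define m where "m = (\<Sum>c\<in>C. max (- l c) 0 *\<^sub>R c)"
  have "p \<odot> m = 0"
    unfolding p_def m_def mult_combinations[OF C(2)]
    by (intro sum.neutral) (auto simp: max_def)
  then have "inner p m = 0"
    using inner_mult_unit[of p m] by simp
  moreover have "p \<in> M"
    unfolding p_def using C(1) assms(1)
    by (intro subspace_sum subspace_mul) (auto simp: jordan_subalgebra_def)
  moreover have "x = p - m"
    unfolding x p_def m_def
    by (simp flip: sum_subtractf scaleR_diff_left) (intro sum.cong, auto simp: max_def)
  moreover have "p \<in> squares" "m \<in> squares"
    unfolding p_def m_def by (auto intro!: nonneg_combination_mem C(2))
  ultimately show thesis using that by blast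
qed

text \<open>The decomposition \<open>x = p - m\<close> is the Moreau decomposition, so \<open>p\<close> is the projection of \<open>x\<close>.\<close>

lemma dist_projection:
  assumes "p \<in> squares" "m \<in> squares" "inner p m = 0" "z \<in> squares"
  shows "(dist (p - m) p)\<^sup>2 + (dist p z)\<^sup>2 \<le> (dist (p - m) z)\<^sup>2"
proof -
  have "(dist (p - m) z)\<^sup>2 = (dist (p - m) p)\<^sup>2 + (dist p z)\<^sup>2 + 2 * inner m z"
    using assms(3)
    by (simp add: dist_norm power2_norm_eq_inner inner_simps inner_commute algebra_simps)
  with inner_squares_nonneg[OF assms(2,4)] show ?thesis by simp
qed

text \<open>Both translated cones are isometric images of \<open>squares\<close>, under which the
  projection corresponds to that of \<open>p - m\<close> onto \<open>squares\<close>.\<close>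

lemma closest_point_squares:
  assumes "p \<in> squares" "m \<in> squares" "inner p m = 0"
  shows "lattice_inf squares x (x - (p - m)) = x - p" "lattice_sup squares x (x + (p - m)) = x + p"
proof -
  \<comment> \<open>\<open>closest_point\<close> is a choice operator, so its value is determined by
    showing that \<open>p\<close> is the only minimiser.\<close>
  have unique: "z = p" if "z \<in> squares" "dist (p - m) z \<le> dist (p - m) p" for z
  proof -
    have "(dist (p - m) z)\<^sup>2 \<le> (dist (p - m) p)\<^sup>2"
      using that(2) by (simp add: power_mono)
    then have "(dist p z)\<^sup>2 \<le> 0"
      using dist_projection[OF assms that(1)] by linarith
    then show ?thesis by simp
  qed
  have min: "dist (p - m) p \<le> dist (p - m) z" if "z \<in> squares" for z
  proof (rule power2_le_imp_le)
    show "(dist (p - m) p)\<^sup>2 \<le> (dist (p - m) z)\<^sup>2"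
      using dist_projection[OF assms that] zero_le_power2[of "dist p z"] by linarith
  qed simp
  have d: "dist (x - a) (x - b) = dist a b" "dist (x + a) (x + b) = dist a b" for a b
    by (simp_all add: dist_norm norm_minus_commute)
  show "lattice_inf squares x (x - (p - m)) = x - p"
    unfolding lattice_inf_def closest_point_def
    by (rule some_equality) (use assms(1) unique min in \<open>auto simp: d\<close>)
  show "lattice_sup squares x (x + (p - m)) = x + p"
    unfolding lattice_sup_def closest_point_def
    by (rule some_equality) (use assms(1) unique min in \<open>auto simp: d\<close>)
qed

text \<open>The two operations at \<open>x\<close>, \<open>y\<close> only involve the projections of
  \<open>x - y\<close> and \<open>y - x\<close> onto the cone, so it suffices that \<open>M\<close>
  contains the positive parts of its elements.\<close>

lemma lattice_like_subspaceI:
  assumes "subspace M"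
    and parts: "\<And>x. x \<in> M \<Longrightarrow> \<exists>p m. p \<in> M \<and> p \<in> squares \<and> m \<in> squares \<and> x = p - m \<and> inner p m = 0"
  shows "lattice_like_subspace squares M"
  unfolding lattice_like_subspace_def
proof (intro conjI ballI)
  fix x y assume xy: "x \<in> M" "y \<in> M"
  then have "x - y \<in> M" "y - x \<in> M"
    using assms(1) by (simp_all add: subspace_diff)
  obtain p m where p: "p \<in> M" "p \<in> squares" "m \<in> squares" "x - y = p - m" "inner p m = 0"
    using parts[OF \<open>x - y \<in> M\<close>] by blast
  have "y = x - (p - m)" by (simp flip: p(4))
  then show "lattice_inf squares x y \<in> M"
    using closest_point_squares(1)[OF p(2,3,5), of x] p(1) xy assms(1) by (simp add: subspace_diff)
  obtain p m where p: "p \<in> M" "p \<in> squares" "m \<in> squares" "y - x = p - m" "inner p m = 0"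
    using parts[OF \<open>y - x \<in> M\<close>] by blast
  have "y = x + (p - m)" by (simp flip: p(4))
  then show "lattice_sup squares x y \<in> M"
    using closest_point_squares(2)[OF p(2,3,5), of x] p(1) xy assms(1) by (simp add: subspace_add)
qed (fact assms(1))

lemma lattice_like_subspace_subalgebra:
  assumes "jordan_subalgebra (\<odot>) M"
  shows "lattice_like_subspace squares M"
proof (rule lattice_like_subspaceI)
  show "subspace M" using assms by (simp add: jordan_subalgebra_def)
qed (meson assms pos_neg_parts)

lemma lattice_like_subspace_span_square:
  assumes "q \<in> squares"
  shows "lattice_like_subspace squares (span {q})"
proof (rule lattice_like_subspaceI)
  fix x assume "x \<in> span {q}"
  then obtain t where x: "x = t *\<^sub>R q" by (auto simp: span_singleton)
  \<comment> \<open>According to the sign of \<open>t\<close>, one of the two parts is zero, so they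
    are orthogonal.\<close>
  show "\<exists>p m. p \<in> span {q} \<and> p \<in> squares \<and> m \<in> squares \<and> x = p - m \<and> inner p m = 0"
    using assms
    by (intro exI[of _ "max t 0 *\<^sub>R q"] exI[of _ "max (- t) 0 *\<^sub>R q"])
      (auto simp: x scale_mem max_def zero_mem span_base span_mul span_zero)
qed simp

section \<open>Self-duality of the cone and the order unit\<close>

lemma span_squares: "span squares = UNIV"
proof -
  have "x \<in> span squares" for x
  proof -
    have "(x + e) \<odot> (x + e) - x \<odot> x - e \<odot> e \<in> span squares"
      by (intro span_diff span_base square_mem)
    moreover have "(x + e) \<odot> (x + e) - x \<odot> x - e \<odot> e = 2 *\<^sub>R x"
      by (simp add: mult_simps unit_left unit_right scaleR_2)
    ultimately have "(1/2) *\<^sub>R (2 *\<^sub>R x) \<in> span squares"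
      by (metis span_mul)
    then show ?thesis by simp
  qed
  then show ?thesis by blast
qed

text \<open>Testing \<open>x = p - m\<close> against its own negative part \<open>m\<close> gives
  minus the squared norm of \<open>m\<close>, so \<open>m = 0\<close>.\<close>

lemma self_dual:
  assumes "\<And>q. q \<in> squares \<Longrightarrow> 0 \<le> inner x q"
  shows "x \<in> squares"
proof -
  have "jordan_subalgebra (\<odot>) UNIV" by (simp add: jordan_subalgebra_def)
  then obtain p m where pm: "p \<in> squares" "m \<in> squares" "x = p - m" "inner p m = 0"
    using pos_neg_parts[of UNIV x] by blast
  then have "0 \<le> inner (p - m) m" using assms by blast
  then have "m = 0"
    using pm(4) inner_ge_zero[of m] by (simp add: inner_diff_left)
  with pm show ?thesis by simp
qed

lemma add_mem: "p \<in> squares \<Longrightarrow> q \<in> squares \<Longrightarrow> p + q \<in> squares"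
  by (rule self_dual) (simp add: inner_add_left inner_squares_nonneg)

text \<open>If \<open>K\<close> bounds multiplication by \<open>x\<close>, then pairing
  \<open>x\<close> with \<open>b \<odot> b\<close> gives at most \<open>K\<close> times the squared
  norm of \<open>b\<close>, which is the pairing of \<open>K *\<^sub>R e\<close> with
  \<open>b \<odot> b\<close>. Self-duality turns this into the cone order.\<close>

lemma order_unit:
  obtains s where "0 < s" "s *\<^sub>R e - x \<in> squares"
proof -
  obtain K where K: "\<And>y. norm (x \<odot> y) \<le> K * norm y" "K > 0"
    using linear_bounded_pos[OF linear_mult] by blast
  have "K *\<^sub>R e - x \<in> squares"
  proof (rule self_dual)
    fix m assume "m \<in> squares"
    then obtain b where b: "m = b \<odot> b"
      by (auto simp: cone_of_squares_def)
    have "inner x m = inner (x \<odot> b) b"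
      unfolding b by (metis inner_assoc inner_commute mult_commute)
    also have "\<dots> \<le> norm (x \<odot> b) * norm b"
      by (rule norm_cauchy_schwarz)
    also have "\<dots> \<le> K * norm b * norm b"
      by (intro mult_right_mono K) simp
    also have "\<dots> = inner (K *\<^sub>R e) m"
      using inner_mult_unit[of b b] unfolding b
      by (simp add: inner_commute dot_square_norm power2_eq_square)
    finally show "0 \<le> inner (K *\<^sub>R e - x) m"
      by (simp add: inner_diff_left)
  qed
  with K(2) show thesis using that by blast
qed

section \<open>Spans of faces are subalgebras\<close>

lemma square_le_scale:
  assumes "a \<in> squares"
  obtains s where "0 \<le> s" "s *\<^sub>R a - a \<odot> a \<in> squares"
proof -
  obtain C l where C: "orthogonal_idempotents C" and a: "a = (\<Sum>c\<in>C. l c *\<^sub>R c)"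
    using spectral_decomposition[of UNIV a] by (auto simp: jordan_subalgebra_def)
  have fin: "finite C" using C by (simp add: orthogonal_idempotents_def)
  \<comment> \<open>Orthogonality isolates the coefficient of \<open>c\<close> when \<open>a\<close>
    is paired with \<open>c\<close>, and both \<open>a\<close> and \<open>c\<close> are
    squares.\<close>
  have pos: "0 \<le> l c" if "c \<in> C" for c
  proof -
    have "c \<odot> c = c" "c \<noteq> 0" using C that by (auto simp: orthogonal_idempotents_def)
    have "inner a c = (\<Sum>d\<in>C. l d * inner d c)"
      by (simp add: a inner_sum_left)
    also have "\<dots> = (\<Sum>d\<in>C. if d = c then l c * inner c c else 0)"
    proof (intro sum.cong refl)
      fix d assume "d \<in> C"
      then show "l d * inner d c = (if d = c then l c * inner c c else 0)"
        using C that inner_mult_unit[of d c] by (auto simp: orthogonal_idempotents_def)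
    qed
    also have "\<dots> = l c * inner c c" using fin that by simp
    finally have "0 \<le> l c * inner c c"
      using inner_squares_nonneg[OF assms square_mem[of c]] \<open>c \<odot> c = c\<close> by simp
    then show ?thesis
      using \<open>c \<noteq> 0\<close> by (simp add: zero_le_mult_iff) (metis inner_gt_zero_iff not_le)
  qed
  \<comment> \<open>Any upper bound of the coefficients works, because
    \<open>(s - l c) * l c\<close> is then nonnegative; their sum is one.\<close>
  define s where "s = sum l C"
  have "l c \<le> s" if "c \<in> C" for c
    unfolding s_def using that fin pos by (intro member_le_sum) auto
  moreover have "s *\<^sub>R a - a \<odot> a = (\<Sum>c\<in>C. ((s - l c) * l c) *\<^sub>R c)"
    unfolding a mult_combinations[OF C]
    by (simp add: scaleR_sum_right algebra_simps flip: sum_subtractf)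
  ultimately have "s *\<^sub>R a - a \<odot> a \<in> squares"
    using nonneg_combination_mem[OF C] pos by simp
  moreover have "0 \<le> s" unfolding s_def using pos by (intro sum_nonneg) auto
  ultimately show thesis using that by blast
qed

lemma cone_face_square:
  assumes F: "cone_face squares F" and "a \<in> F"
  shows "a \<odot> a \<in> F"
proof -
  have "a \<in> squares" using assms by (auto simp: cone_face_def)
  then obtain s where s: "0 \<le> s" "s *\<^sub>R a - a \<odot> a \<in> squares"
    using square_le_scale by blast
  have "s *\<^sub>R a \<in> F"
    using assms s(1) by (auto simp: cone_face_def convex_cone_def conic_def)
  then show ?thesis
    using F s(2) square_mem[of a] unfolding cone_face_def cone_le_def by (metis diff_zero)
qed

lemma span_face_subalgebra:
  assumes F: "cone_face squares F"
  shows "jordan_subalgebra (\<odot>) (span F)"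
proof -
  have FF: "a \<odot> b \<in> span F" if "a \<in> F" "b \<in> F" for a b
  proof -
    have "a + b \<in> F"
      using F that by (auto simp: cone_face_def convex_cone_add)
    then have "(a + b) \<odot> (a + b) - a \<odot> a - b \<odot> b \<in> span F"
      using that by (intro span_diff span_base cone_face_square[OF F])
    moreover have "(a + b) \<odot> (a + b) - a \<odot> a - b \<odot> b = 2 *\<^sub>R (a \<odot> b)"
      by (simp add: mult_simps scaleR_2 mult_commute[of b a])
    ultimately have "(1/2) *\<^sub>R (2 *\<^sub>R (a \<odot> b)) \<in> span F"
      by (metis span_mul)
    then show ?thesis by simp
  qed
  have FS: "a \<odot> y \<in> span F" if "a \<in> F" "y \<in> span F" for a y
    using that(2) by (induction rule: span_induct_alt)
      (auto simp: mult_simps FF that(1) intro!: span_zero span_add span_mul)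
  have "x \<odot> y \<in> span F" if "x \<in> span F" "y \<in> span F" for x y
    using that(1) by (induction rule: span_induct_alt)
      (auto simp: mult_simps FS that(2) intro!: span_zero span_add span_mul)
  then show ?thesis by (simp add: jordan_subalgebra_def)
qed

section \<open>Strictness of both inclusions\<close>

lemma subalgebra_span_unit: "jordan_subalgebra (\<odot>) (span {e})"
  unfolding jordan_subalgebra_def
proof (intro conjI subspace_span)
  show "\<forall>x\<in>span {e}. \<forall>y\<in>span {e}. x \<odot> y \<in> span {e}"
    by (auto simp: span_singleton mult_simps unit_left)
qed

lemma span_unit_neq_UNIV:
  assumes "DIM('a) \<ge> 2"
  shows "span {e} \<noteq> UNIV"
proof
  assume "span {e} = UNIV"
  then have "DIM('a) = dim {e}" by (metis dim_span dim_UNIV)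
  also have "\<dots> \<le> 1" using dim_le_card'[of "{e}"] by simp
  finally show False using assms by simp
qed

lemma span_face_neq_span_unit:
  assumes F: "cone_face squares F" and "DIM('a) \<ge> 2"
  shows "span F \<noteq> span {e}"
proof
  assume eq: "span F = span {e}"
  have "e \<noteq> 0"
    using span_unit_neq_UNIV[OF assms(2)] unit_left mult_simps(9) by (metis UNIV_eq_I span_zero)
  have "\<not> F \<subseteq> {0}"
  proof
    assume "F \<subseteq> {0}"
    then have "span F \<subseteq> {0}" by (metis span_mono span_0 span_insert_0 span_empty)
    with eq \<open>e \<noteq> 0\<close> show False by (metis span_base singletonD singletonI subsetD)
  qed
  then obtain f where f: "f \<in> F" "f \<noteq> 0" by blast
  then obtain t where t: "f = t *\<^sub>R e"
    using eq span_base[of f F] by (auto simp: span_singleton)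
  have "0 \<le> inner f (e \<odot> e)"
    using F f inner_squares_nonneg square_mem by (auto simp: cone_face_def)
  moreover have "inner e e > 0"
    using \<open>e \<noteq> 0\<close> by simp
  ultimately have "0 \<le> t"
    by (simp add: t unit_left zero_le_mult_iff not_le del: inner_gt_zero_iff)
  then have "0 < t"
    using t f(2) by auto
  \<comment> \<open>\<open>F\<close> contains a positive multiple of the order unit
    \<open>e\<close>, so the face property absorbs every square.\<close>
  have "squares \<subseteq> F"
  proof
    fix x assume x: "x \<in> squares"
    obtain s where s: "0 < s" "s *\<^sub>R e - x \<in> squares" using order_unit by blast
    have "s *\<^sub>R e = (s / t) *\<^sub>R f" using t \<open>0 < t\<close> by simp
    moreover have "(s / t) *\<^sub>R f \<in> F"
      using F f s \<open>0 < t\<close> by (auto simp: cone_face_def convex_cone_def conic_def)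
    ultimately show "x \<in> F"
      using F s x unfolding cone_face_def cone_le_def by (metis diff_zero)
  qed
  then have "span F = UNIV"
    using span_squares span_mono by blast
  with eq span_unit_neq_UNIV[OF assms(2)] show False by simp
qed

text \<open>Otherwise every square is an eigenvector of its own multiplication. Comparing a square
  \<open>q\<close> outside the line of \<open>e\<close> with \<open>q + e\<close> forces
  \<open>l' = l + 2\<close> and \<open>(l + 1) *\<^sub>R e = 0\<close>, which contradicts
  \<open>0 \<le> l\<close>. So all squares lie on that line, although they span the whole
  space.\<close>

lemma ex_square_span_not_subalgebra:
  assumes "DIM('a) \<ge> 2"
  obtains q where "q \<in> squares" "\<not> jordan_subalgebra (\<odot>) (span {q})"
proof (rule ccontr)
  note * = that
  assume "\<not> thesis"
  then have all: "jordan_subalgebra (\<odot>) (span {q})" if "q \<in> squares" for q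
    using * that \<open>\<not> thesis\<close> by blast
  have eig: "\<exists>l. q \<odot> q = l *\<^sub>R q" if "q \<in> squares" for q
  proof -
    have "q \<odot> q \<in> span {q}"
      using all[OF that] by (simp add: jordan_subalgebra_def span_base)
    then show ?thesis by (auto simp: span_singleton)
  qed
  have "squares \<subseteq> span {e}"
  proof
    fix q assume q: "q \<in> squares"
    show "q \<in> span {e}"
    proof (rule ccontr)
      assume nq: "q \<notin> span {e}"
      obtain l where l: "q \<odot> q = l *\<^sub>R q" using eig[OF q] by blast
      obtain y where y: "q = y \<odot> y" using q by (auto simp: cone_of_squares_def)
      have lpos: "0 \<le> l"
      proof -
        have "inner q e \<ge> 0" using inner_mult_unit[of y y] y by simp
        moreover have "l * inner q e = inner q q"
          using inner_mult_unit[of q q] l by simp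
        moreover have "q \<noteq> 0" using nq span_zero by auto
        ultimately show ?thesis
          by (metis inner_gt_zero_iff less_eq_real_def mult_nonpos_nonneg not_le)
      qed
      have "q + e \<in> squares"
        using add_mem[OF q square_mem[of e]] by (simp add: unit_left)
      then obtain l' where "(q + e) \<odot> (q + e) = l' *\<^sub>R (q + e)" using eig by blast
      then have eq: "(l + 2 - l') *\<^sub>R q = (l' - 1) *\<^sub>R e"
        by (simp add: mult_simps unit_left unit_right l scaleR_2 algebra_simps)
      have "l' = l + 2"
      proof (rule ccontr)
        assume "l' \<noteq> l + 2"
        then have "q = (1 / (l + 2 - l')) *\<^sub>R ((l + 2 - l') *\<^sub>R q)" by simp
        also have "\<dots> \<in> span {e}" unfolding eq by (intro span_mul span_base) simp
        finally show False using nq by contradiction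
      qed
      with eq lpos have "e = 0" by auto
      then have "q = 0" using unit_left[of q] mult_simps(9) by simp
      with nq show False by (simp add: span_zero)
    qed
  qed
  then have "span {e} = UNIV"
    using span_squares span_minimal[of squares "span {e}"] by auto
  with span_unit_neq_UNIV[OF assms] show False by simp
qed

end

theorem corollary5:
  fixes jmult :: "'a::euclidean_space \<Rightarrow> 'a \<Rightarrow> 'a" and e :: 'a
  assumes "euclidean_jordan_algebra jmult e"
    and "DIM('a) \<ge> 2"
  shows "{span F | F. cone_face (cone_of_squares jmult) F} \<subset> {A. jordan_subalgebra jmult A}
       \<and> {A. jordan_subalgebra jmult A} \<subset> {L. lattice_like_subspace (cone_of_squares jmult) L}"
proof (intro conjI psubsetI)
  interpret euclidean_jordan_algebra jmult e by fact
  show "{span F | F. cone_face squares F} \<subseteq> {A. jordan_subalgebra jmult A}"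
    using span_face_subalgebra by blast
  show "{span F | F. cone_face squares F} \<noteq> {A. jordan_subalgebra jmult A}"
  proof -
    have "span {e} \<notin> {span F | F. cone_face squares F}"
      using span_face_neq_span_unit[OF _ assms(2)] by fastforce
    then show ?thesis using subalgebra_span_unit by blast
  qed
  show "{A. jordan_subalgebra jmult A} \<subseteq> {L. lattice_like_subspace squares L}"
    using lattice_like_subspace_subalgebra by blast
  show "{A. jordan_subalgebra jmult A} \<noteq> {L. lattice_like_subspace squares L}"
  proof -
    obtain q where "q \<in> squares" "\<not> jordan_subalgebra jmult (span {q})"
      using ex_square_span_not_subalgebra[OF assms(2)] by metis
    then show ?thesis using lattice_like_subspace_span_square[of q] by blast
  qed
qed

end
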